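(* Let $\alpha,\beta\in(0,1)$ be such that at least one of them is irrational. Then the set $$E_{\alpha,\beta}=\{\mathbf{x}\in\Sigma: \text{the sequence } S_n(\mathbf{x}),\ n\in\mathbb{N},\ \text{is not uniformly distributed modulo one}\}$$ contains a dense $G_\delta$ set in $\Sigma$.
   Context: $\Sigma=\{1,2\}^{\mathbb{N}}$ is the set of sequences $\mathbf{x}=(x_1,x_2,\ldots)$ with $x_n\in\{1,2\}$. It carries the metric $d$ given by $d(\mathbf{x},\mathbf{x})=0$, $d(\mathbf{x},\mathbf{y})=1$ if $x_1\ne y_1$, and otherwise, for $\mathbf{x}\neq\mathbf{y}$ with $x_1=y_1$, $d(\mathbf{x},\mathbf{y})=2^{-k(\mathbf{x},\mathbf{y})}$ where $k(\mathbf{x},\mathbf{y})=\max\{n: x_j=y_j \text{ for all } j\le n\}$; topological notions refer to this metric. A $G_\delta$ set is a countable intersection of open sets. For $\mathbf{x}\in\Sigma$ and $i,n\in\mathbb{N}=\{1,2,\ldots\}$ put $X_i(\mathbf{x})=\alpha$ if $x_i=1$, $X_i(\mathbf{x})=\beta$ if $x_i=2$, and $S_n(\mathbf{x})=\sum_{i=1}^n X_i(\mathbf{x})$. A sequence of real numbers $\xi_n$, $n\in\mathbb{N}$, is uniformly distributed modulo one if for every interval $I\subseteq[0,1)$ one has $\frac{1}{N}\#\{1\le n\le N:\{\xi_n\}\in I\}\to|I|$ as $N\to\infty$, where $\{x\}$ is the fractional part of $x$ and $|I|$ is the length of $I$.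
   Formalization: The hypothesis that α and β are distinct is added: if α = β is irrational, then S_n(x) = nα is uniformly distributed modulo one for every x, so E_{α,β} is empty and the claim fails. *)

theory Defs
  imports "HOL-Analysis.Analysis"
begin

text \<open>Sequences are indexed by \<open>{1, 2, \<dots>}\<close>; extensionality fixes the irrelevant value at
  index \<open>0\<close>, so that equality in \<open>Sigma12\<close> is equality of sequences.\<close>

definition Sigma12 :: "(nat \<Rightarrow> nat) set" where
  "Sigma12 = ({1..} \<rightarrow>\<^sub>E {1, 2})"

definition agree_len :: "(nat \<Rightarrow> nat) \<Rightarrow> (nat \<Rightarrow> nat) \<Rightarrow> nat" where
  "agree_len x y = Max {n. 1 \<le> n \<and> (\<forall>j\<in>{1..n}. x j = y j)}"

definition seq_dist :: "(nat \<Rightarrow> nat) \<Rightarrow> (nat \<Rightarrow> nat) \<Rightarrow> real" where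
  "seq_dist x y =
     (if x = y then 0
      else if x 1 \<noteq> y 1 then 1
      else 2 powr (- real (agree_len x y)))"

lemma seq_dist_first_difference:
  assumes "1 \<le> m" "x m \<noteq> y m" "\<And>j. 1 \<le> j \<Longrightarrow> j < m \<Longrightarrow> x j = y j"
  shows "seq_dist x y = 2 powr (- real (m - 1))"
proof (cases "m = 1")
  case True
  then show ?thesis using assms by (auto simp: seq_dist_def)
next
  case False
  have "{n. 1 \<le> n \<and> (\<forall>j\<in>{1..n}. x j = y j)} = {1..m - 1}"
  proof (intro set_eqI iffI)
    fix n assume n: "n \<in> {n. 1 \<le> n \<and> (\<forall>j\<in>{1..n}. x j = y j)}"
    then have "n < m" using assms(1,2) by (metis (mono_tags, lifting) atLeastAtMost_iff mem_Collect_eq not_less)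
    then show "n \<in> {1..m - 1}" using n by auto
  next
    fix n assume "n \<in> {1..m - 1}"
    then show "n \<in> {n. 1 \<le> n \<and> (\<forall>j\<in>{1..n}. x j = y j)}" using assms(3) by auto
  qed
  moreover have "Max {1..m - 1} = m - 1"
    using False assms(1) by (intro Max_eqI) auto
  ultimately have "agree_len x y = m - 1"
    by (simp add: agree_len_def)
  moreover have "x 1 = y 1" using assms False by auto
  ultimately show ?thesis using assms(2) by (auto simp: seq_dist_def)
qed

lemma ex_first_difference:
  assumes "x \<in> Sigma12" "y \<in> Sigma12" "x \<noteq> y"
  obtains m where "1 \<le> m" "x m \<noteq> y m" "\<And>j. 1 \<le> j \<Longrightarrow> j < m \<Longrightarrow> x j = y j"
proof -
  let ?P = "\<lambda>m. 1 \<le> m \<and> x m \<noteq> y m"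
  have "\<exists>m. ?P m"
    using assms unfolding Sigma12_def by (metis PiE_ext atLeast_iff)
  then have "?P (LEAST m. ?P m)" by (rule LeastI_ex)
  then show ?thesis using that not_less_Least[of _ ?P] by blast
qed

interpretation Sigma12: Metric_space Sigma12 seq_dist
proof
  fix x y z :: "nat \<Rightarrow> nat"
  show "0 \<le> seq_dist x y" by (simp add: seq_dist_def)
  show "seq_dist x y = seq_dist y x"
    by (simp add: seq_dist_def agree_len_def eq_commute)
  show "seq_dist x y = 0 \<longleftrightarrow> x = y" by (simp add: seq_dist_def)
  assume S: "x \<in> Sigma12" "y \<in> Sigma12" "z \<in> Sigma12"
  have nn: "0 \<le> seq_dist u v" for u v by (simp add: seq_dist_def)
  have lower: "2 powr (- real (m - 1)) \<le> seq_dist u v"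
    if uv: "u \<in> Sigma12" "v \<in> Sigma12" and m: "1 \<le> m" "u m \<noteq> v m" for u v m
  proof -
    obtain p where p: "1 \<le> p" "u p \<noteq> v p" "\<And>j. 1 \<le> j \<Longrightarrow> j < p \<Longrightarrow> u j = v j"
      using ex_first_difference[OF uv] m by metis
    then have "p \<le> m" using m by (meson not_less)
    then show ?thesis using seq_dist_first_difference[of p u v, OF p(1,2)] p(3) by simp
  qed
  show "seq_dist x z \<le> seq_dist x y + seq_dist y z"
  proof (cases "x = z")
    case True
    then show ?thesis using nn[of x y] nn[of y z] by (simp add: seq_dist_def)
  next
    case False
    then obtain m where m: "1 \<le> m" "x m \<noteq> z m" "\<And>j. 1 \<le> j \<Longrightarrow> j < m \<Longrightarrow> x j = z j"
      using ex_first_difference S by metis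
    then have "x m \<noteq> y m \<or> y m \<noteq> z m" by auto
    then show ?thesis
      using lower[OF S(1,2) m(1)] lower[OF S(2,3) m(1)] seq_dist_first_difference[of m x z, OF m(1,2)] m(3)
        nn[of x y] nn[of y z] by fastforce
  qed
qed

definition Sigma12_top :: "(nat \<Rightarrow> nat) topology" where
  "Sigma12_top = Sigma12.mtopology"

text \<open>Only the terms \<open>\<xi> n\<close> with \<open>n \<ge> 1\<close> matter. Intervals of every kind (open, closed, half-open,
  degenerate) are allowed, and the length is the Lebesgue measure.\<close>

definition uniformly_distributed_mod1 :: "(nat \<Rightarrow> real) \<Rightarrow> bool" where
  "uniformly_distributed_mod1 \<xi> \<longleftrightarrow>
     (\<forall>I. is_interval I \<and> I \<subseteq> {0..<1} \<longrightarrow>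
        (\<lambda>N. real (card {n \<in> {1..N}. frac (\<xi> n) \<in> I}) / real N) \<longlonglongrightarrow> measure lborel I)"

definition step :: "real \<Rightarrow> real \<Rightarrow> (nat \<Rightarrow> nat) \<Rightarrow> nat \<Rightarrow> real" where
  "step \<alpha> \<beta> x i = (if x i = 1 then \<alpha> else \<beta>)"

definition walk :: "real \<Rightarrow> real \<Rightarrow> (nat \<Rightarrow> nat) \<Rightarrow> nat \<Rightarrow> real" where
  "walk \<alpha> \<beta> x n = (\<Sum>i=1..n. step \<alpha> \<beta> x i)"

text \<open>For \<open>\<alpha> = \<beta>\<close> irrational every walk is \<open>n \<mapsto> n * \<alpha>\<close>, which is uniformly distributed modulo one,
  so this set is empty; results on its size therefore need \<open>\<alpha> \<noteq> \<beta>\<close>.\<close>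

definition exceptional_set :: "real \<Rightarrow> real \<Rightarrow> (nat \<Rightarrow> nat) set" where
  "exceptional_set \<alpha> \<beta> =
     {x \<in> Sigma12. \<not> uniformly_distributed_mod1 (\<lambda>n. walk \<alpha> \<beta> x n)}"

end

theory Submission
  imports Defs
begin

text \<open>An arc \<open>{0..<\<epsilon>}\<close> of the circle that is shorter than the circle distance of \<open>\<alpha>\<close> and \<open>\<beta>\<close>
  cannot contain both \<open>t + \<alpha>\<close> and \<open>t + \<beta>\<close>. Hence every finite word can be continued greedily
  so that the walk never visits the arc again, and the sequences whose visiting frequency is at most
  \<open>\<epsilon> / 2\<close> at infinitely many times form a dense set. This set is a \<open>G\<^sub>\<delta>\<close>, since the frequency
  at time \<open>N\<close> depends on finitely many coordinates only.\<close>

lemma seq_dist_less_imp_agree: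
  assumes "x \<in> Sigma12" "y \<in> Sigma12" "seq_dist x y < 2 powr (- real N)" "j \<in> {1..N}"
  shows "x j = y j"
proof (rule ccontr)
  assume ne: "x j \<noteq> y j"
  then obtain m where m: "1 \<le> m" "x m \<noteq> y m" "\<And>i. 1 \<le> i \<Longrightarrow> i < m \<Longrightarrow> x i = y i"
    using ex_first_difference[OF assms(1,2)] by metis
  have "m \<le> j" using m(3)[of j] ne assms(4) by force
  then have "2 powr (- real N) \<le> 2 powr (- real (m - 1))"
    using assms(4) by (intro powr_mono) auto
  then show False
    using seq_dist_first_difference[of m x y, OF m] assms(3) by simp
qed

lemma seq_dist_le_if_agree:
  assumes "x \<in> Sigma12" "y \<in> Sigma12" "\<And>j. j \<in> {1..N} \<Longrightarrow> x j = y j"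
  shows "seq_dist x y \<le> 2 powr (- real N)"
proof (cases "x = y")
  case True
  then show ?thesis by (simp add: seq_dist_def)
next
  case False
  obtain m where m: "1 \<le> m" "x m \<noteq> y m" "\<And>i. 1 \<le> i \<Longrightarrow> i < m \<Longrightarrow> x i = y i"
    using ex_first_difference[OF assms(1,2) False] by metis
  have "N < m" using m(1,2) assms(3)[of m] by force
  then have "2 powr (- real (m - 1)) \<le> 2 powr (- real N)"
    by (intro powr_mono) auto
  then show ?thesis using seq_dist_first_difference[of m x y, OF m] by simp
qed

text \<open>All points of the open ball of radius \<open>2 powr (- real N)\<close> about a point of
  \<open>A\<close> share its first \<open>N\<close> coordinates, so this ball lies in
  \<open>A\<close>.\<close>

lemma openin_Sigma12_if_finitely_determined:
  assumes "A \<subseteq> Sigma12"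
    and "\<And>x y. x \<in> A \<Longrightarrow> y \<in> Sigma12 \<Longrightarrow> (\<And>j. j \<in> {1..N} \<Longrightarrow> x j = y j) \<Longrightarrow> y \<in> A"
  shows "openin Sigma12_top A"
  unfolding Sigma12_top_def Sigma12.openin_mtopology
proof (intro conjI allI impI)
  show "A \<subseteq> Sigma12" by fact
  fix x assume x: "x \<in> A"
  have "Sigma12.mball x (2 powr (- real N)) \<subseteq> A"
    using assms(2)[OF x] seq_dist_less_imp_agree by (auto simp: Sigma12.in_mball)
  then show "\<exists>r>0. Sigma12.mball x r \<subseteq> A" by (intro exI[of _ "2 powr (- real N)"]) simp
qed

lemma closure_of_Sigma12_eq_if_prefixes_extend:
  assumes "A \<subseteq> Sigma12"
    and "\<And>x m. x \<in> Sigma12 \<Longrightarrow> \<exists>y\<in>A. \<forall>j\<in>{1..m}. x j = y j"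
  shows "Sigma12_top closure_of A = topspace Sigma12_top"
proof -
  have "x \<in> Sigma12.mtopology closure_of A" if x: "x \<in> Sigma12" for x
    unfolding Sigma12.metric_closure_of
  proof (intro CollectI conjI allI impI x)
    fix r :: real assume "0 < r"
    then obtain m where "(1/2) ^ m < r"
      using real_arch_pow_inv[of r "1/2"] by auto
    then have m: "2 powr (- real m) < r"
      by (simp add: powr_minus powr_realpow power_one_over inverse_eq_divide)
    obtain y where y: "y \<in> A" "\<forall>j\<in>{1..m}. x j = y j" using assms(2)[OF x] by blast
    then have "y \<in> Sigma12.mball x r"
      using seq_dist_le_if_agree[of x y m] x assms(1) m by (force simp: Sigma12.in_mball)
    then show "\<exists>y\<in>A. y \<in> Sigma12.mball x r" using y by blast
  qed
  then show ?thesis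
    unfolding Sigma12_top_def
    using closure_of_subset_topspace[of Sigma12.mtopology A] by auto
qed

lemma walk_cong:
  assumes "\<And>j. j \<in> {1..n} \<Longrightarrow> x j = y j"
  shows "walk \<alpha> \<beta> x n = walk \<alpha> \<beta> y n"
  unfolding walk_def step_def using assms by (intro sum.cong) auto

text \<open>The difference of the fractional parts is \<open>s - t\<close> plus an integer
  \<open>k\<close>. Its absolute value is \<open>\<bar>s - t\<bar>\<close> if \<open>k = 0\<close>
  and at least \<open>1 - \<bar>s - t\<bar>\<close> otherwise, so it is never below
  \<open>\<epsilon>\<close>.\<close>

lemma frac_not_close:
  fixes s t :: real
  assumes "\<bar>frac s - frac t\<bar> < \<epsilon>" and "\<epsilon> \<le> \<bar>s - t\<bar>" and "\<epsilon> \<le> 1 - \<bar>s - t\<bar>"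
  shows False
proof -
  define k where "k = \<lfloor>t\<rfloor> - \<lfloor>s\<rfloor>"
  have eq: "frac s - frac t = (s - t) + of_int k"
    by (simp add: frac_def k_def)
  consider "k = 0" | "k \<ge> 1" | "k \<le> -1" by linarith
  then show False
  proof cases
    case 1
    then show ?thesis using assms eq by simp
  next
    case 2
    then have "real_of_int k \<ge> 1" by simp
    then show ?thesis using assms eq by linarith
  next
    case 3
    then have "real_of_int k \<le> -1" by linarith
    then show ?thesis using assms eq by linarith
  qed
qed

lemma ex_continuation_avoiding:
  assumes x: "x \<in> Sigma12"
    and J: "\<And>t. frac (t + \<alpha>) \<notin> J \<or> frac (t + \<beta>) \<notin> J"
  shows "\<exists>y\<in>Sigma12. (\<forall>j\<in>{1..m}. x j = y j) \<and> (\<forall>n>m. frac (walk \<alpha> \<beta> y n) \<notin> J)"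
proof -
  \<comment> \<open>\<open>t n\<close> is the position \<open>n\<close> steps after time
    \<open>m\<close>. The rule prefers the step \<alpha> and takes \<beta> only when \<alpha> would
    land in \<open>J\<close>; by the hypothesis on \<open>J\<close>, \<beta> then misses
    \<open>J\<close>.\<close>
  define t where
    "t = rec_nat (walk \<alpha> \<beta> x m) (\<lambda>_ s. if frac (s + \<alpha>) \<in> J then s + \<beta> else s + \<alpha>)"
  have t0: "t 0 = walk \<alpha> \<beta> x m"
    and tSuc: "t (Suc n) = (if frac (t n + \<alpha>) \<in> J then t n + \<beta> else t n + \<alpha>)" for n
    by (simp_all add: t_def)
  \<comment> \<open>Coordinate \<open>m + Suc k\<close> of \<open>y\<close> records the choice made
    at position \<open>t k\<close>, hence the shift by \<open>Suc m\<close>.\<close>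
  define y where
    "y = (\<lambda>n. if n \<le> m then x n else if frac (t (n - Suc m) + \<alpha>) \<in> J then 2 else 1)"
  have walk_y: "walk \<alpha> \<beta> y (m + n) = t n" for n
  proof (induction n)
    case 0
    show ?case using walk_cong[of m y x \<alpha> \<beta>] by (simp add: t0 y_def)
  next
    case (Suc n)
    have "walk \<alpha> \<beta> y (m + Suc n) = walk \<alpha> \<beta> y (m + n) + step \<alpha> \<beta> y (Suc (m + n))"
      by (simp add: walk_def)
    moreover have "step \<alpha> \<beta> y (Suc (m + n)) = (if frac (t n + \<alpha>) \<in> J then \<beta> else \<alpha>)"
      by (simp add: step_def y_def)
    ultimately show ?case
      using Suc.IH by (simp add: tSuc)
  qed
  have "frac (walk \<alpha> \<beta> y n) \<notin> J" if "m < n" for n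
  proof -
    \<comment> \<open>Only positions \<open>t (Suc k)\<close> result from a choice; the starting
      position \<open>t 0\<close> may well lie in \<open>J\<close>.\<close>
    obtain k where "n = m + Suc k" using less_imp_Suc_add[OF \<open>m < n\<close>] by auto
    then show ?thesis using walk_y[of "Suc k"] J[of "t k"] by (auto simp: tSuc)
  qed
  \<comment> \<open>Index \<open>0\<close> falls under \<open>n \<le> m\<close>, so \<open>y\<close>
    inherits its default value there from \<open>x\<close> and stays extensional.\<close>
  moreover have "y \<in> Sigma12"
    using x by (auto simp: Sigma12_def y_def PiE_iff extensional_def)
  ultimately show ?thesis by (intro bexI[of _ y]) (auto simp: y_def)
qed

definition visits :: "real \<Rightarrow> real \<Rightarrow> real set \<Rightarrow> (nat \<Rightarrow> nat) \<Rightarrow> nat \<Rightarrow> nat" where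
  "visits \<alpha> \<beta> J x N = card {n \<in> {1..N}. frac (walk \<alpha> \<beta> x n) \<in> J}"

lemma visits_cong:
  assumes "\<And>j. j \<in> {1..N} \<Longrightarrow> x j = y j"
  shows "visits \<alpha> \<beta> J x N = visits \<alpha> \<beta> J y N"
proof -
  have "walk \<alpha> \<beta> x n = walk \<alpha> \<beta> y n" if "n \<in> {1..N}" for n
    using that assms by (intro walk_cong) auto
  then show ?thesis
    unfolding visits_def by (intro arg_cong[where f = card]) auto
qed

text \<open>The intersection over \<open>M\<close> expresses "for infinitely many \<open>N\<close>"
  as a countable intersection of sets that turn out to be open. Comparing with
  \<open>c * real N\<close> avoids a quotient at \<open>N = 0\<close>.\<close>

definition rarely_visiting :: "real \<Rightarrow> real \<Rightarrow> real set \<Rightarrow> real \<Rightarrow> (nat \<Rightarrow> nat) set" where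
  "rarely_visiting \<alpha> \<beta> J c =
     (\<Inter>M. {x \<in> Sigma12. \<exists>N\<ge>M. real (visits \<alpha> \<beta> J x N) \<le> c * real N})"

lemma gdelta_in_rarely_visiting: "gdelta_in Sigma12_top (rarely_visiting \<alpha> \<beta> J c)"
proof -
  have "openin Sigma12_top {x \<in> Sigma12. \<exists>N\<ge>M. real (visits \<alpha> \<beta> J x N) \<le> c * real N}" for M
  proof -
    have "openin Sigma12_top {x \<in> Sigma12. real (visits \<alpha> \<beta> J x N) \<le> c * real N}" for N
    proof (rule openin_Sigma12_if_finitely_determined[where N = N])
      fix x y
      assume "x \<in> {x \<in> Sigma12. real (visits \<alpha> \<beta> J x N) \<le> c * real N}" "y \<in> Sigma12"
        and "\<And>j. j \<in> {1..N} \<Longrightarrow> x j = y j"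
      then show "y \<in> {x \<in> Sigma12. real (visits \<alpha> \<beta> J x N) \<le> c * real N}"
        using visits_cong[of N x y \<alpha> \<beta> J] by simp
    qed auto
    then have "openin Sigma12_top
        (\<Union>N\<in>{M..}. {x \<in> Sigma12. real (visits \<alpha> \<beta> J x N) \<le> c * real N})"
      by blast
    moreover have "(\<Union>N\<in>{M..}. {x \<in> Sigma12. real (visits \<alpha> \<beta> J x N) \<le> c * real N})
        = {x \<in> Sigma12. \<exists>N\<ge>M. real (visits \<alpha> \<beta> J x N) \<le> c * real N}"
      by auto
    ultimately show ?thesis by simp
  qed
  then show ?thesis
    unfolding rarely_visiting_def
    by (intro gdelta_in_Inter) (auto intro: open_imp_gdelta_in)
qed

lemma dense_rarely_visiting:
  assumes "c > 0" and J: "\<And>t. frac (t + \<alpha>) \<notin> J \<or> frac (t + \<beta>) \<notin> J"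
  shows "Sigma12_top closure_of rarely_visiting \<alpha> \<beta> J c = topspace Sigma12_top"
proof (rule closure_of_Sigma12_eq_if_prefixes_extend)
  show "rarely_visiting \<alpha> \<beta> J c \<subseteq> Sigma12" by (auto simp: rarely_visiting_def)
  fix x m assume "x \<in> Sigma12"
  then obtain y where y: "y \<in> Sigma12" "\<forall>j\<in>{1..m}. x j = y j"
    and avoid: "\<forall>n>m. frac (walk \<alpha> \<beta> y n) \<notin> J"
    using ex_continuation_avoiding[OF _ J] by blast
  have bound: "visits \<alpha> \<beta> J y N \<le> m" for N
  proof -
    have "{n \<in> {1..N}. frac (walk \<alpha> \<beta> y n) \<in> J} \<subseteq> {1..m}"
      using avoid by (auto simp: not_less[symmetric])
    then have "visits \<alpha> \<beta> J y N \<le> card {1..m}"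
      unfolding visits_def by (intro card_mono) auto
    then show ?thesis by simp
  qed
  \<comment> \<open>The number of visits stays at most \<open>m\<close>, whereas
    \<open>c * real N\<close> exceeds \<open>m\<close> from \<open>N0\<close> on. Thus
    \<open>max M N0\<close> is a witness for each \<open>M\<close>.\<close>
  obtain N0 where N0: "real m < real N0 * c" using reals_Archimedean3[OF assms(1)] by blast
  have "\<exists>N\<ge>M. real (visits \<alpha> \<beta> J y N) \<le> c * real N" for M
  proof (intro exI conjI)
    have "real N0 * c \<le> real (max M N0) * c" using assms(1) by (intro mult_right_mono) auto
    moreover have "real (visits \<alpha> \<beta> J y (max M N0)) \<le> real m" using bound by simp
    ultimately show "real (visits \<alpha> \<beta> J y (max M N0)) \<le> c * real (max M N0)"
      using N0 by (simp add: mult.commute)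
  qed simp
  then have "y \<in> rarely_visiting \<alpha> \<beta> J c" using y by (auto simp: rarely_visiting_def)
  then show "\<exists>y\<in>rarely_visiting \<alpha> \<beta> J c. \<forall>j\<in>{1..m}. x j = y j" using y by blast
qed

text \<open>Under uniform distribution the visiting frequency would tend to the length of
  \<open>J\<close> and so eventually stay above \<open>c\<close>.\<close>

lemma rarely_visiting_subset_exceptional_set:
  assumes "is_interval J" "J \<subseteq> {0..<1}" "c < measure lborel J"
  shows "rarely_visiting \<alpha> \<beta> J c \<subseteq> exceptional_set \<alpha> \<beta>"
proof
  fix x assume x: "x \<in> rarely_visiting \<alpha> \<beta> J c"
  have "\<not> uniformly_distributed_mod1 (walk \<alpha> \<beta> x)"
  proof
    assume "uniformly_distributed_mod1 (walk \<alpha> \<beta> x)"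
    then have "(\<lambda>N. real (visits \<alpha> \<beta> J x N) / real N) \<longlonglongrightarrow> measure lborel J"
      using assms(1,2) by (simp add: uniformly_distributed_mod1_def visits_def)
    then have "eventually (\<lambda>N. c < real (visits \<alpha> \<beta> J x N) / real N) sequentially"
      using assms(3) by (rule order_tendstoD)
    then obtain M where M: "\<And>N. N \<ge> M \<Longrightarrow> c < real (visits \<alpha> \<beta> J x N) / real N"
      by (auto simp: eventually_sequentially)
    \<comment> \<open>\<open>Suc M\<close> instead of \<open>M\<close> ensures \<open>N > 0\<close>,
      so that the quotient by \<open>N\<close> can be cleared.\<close>
    obtain N where "N \<ge> Suc M" "real (visits \<alpha> \<beta> J x N) \<le> c * real N"
      using x by (auto simp: rarely_visiting_def)
    then show False using M[of N] by (simp add: field_simps)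
  qed
  then show "x \<in> exceptional_set \<alpha> \<beta>"
    using x by (auto simp: exceptional_set_def rarely_visiting_def)
qed

theorem theorem1p3:
  fixes \<alpha> \<beta> :: real
  assumes "\<alpha> \<in> {0<..<1}" and "\<beta> \<in> {0<..<1}"
    and "\<alpha> \<notin> \<rat> \<or> \<beta> \<notin> \<rat>"
    and "\<alpha> \<noteq> \<beta>"
  shows "\<exists>G. gdelta_in Sigma12_top G
           \<and> Sigma12_top closure_of G = topspace Sigma12_top
           \<and> G \<subseteq> exceptional_set \<alpha> \<beta>"
proof -
  \<comment> \<open>The distance of \<alpha> and \<beta> on the circle. It is positive because they
    are distinct and both lie strictly between 0 and 1.\<close>
  define \<epsilon> where "\<epsilon> = min \<bar>\<alpha> - \<beta>\<bar> (1 - \<bar>\<alpha> - \<beta>\<bar>)"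
  have eps: "0 < \<epsilon>" "\<epsilon> < 1" using assms by (auto simp: \<epsilon>_def)
  have avoid: "frac (t + \<alpha>) \<notin> {0..<\<epsilon>} \<or> frac (t + \<beta>) \<notin> {0..<\<epsilon>}" for t
  proof (rule ccontr)
    assume "\<not> ?thesis"
    then have "frac (t + \<alpha>) < \<epsilon>" "frac (t + \<beta>) < \<epsilon>" by auto
    then have "\<bar>frac (t + \<alpha>) - frac (t + \<beta>)\<bar> < \<epsilon>"
      using frac_ge_0[of "t + \<alpha>"] frac_ge_0[of "t + \<beta>"] by linarith
    then show False by (rule frac_not_close) (auto simp: \<epsilon>_def)
  qed
  \<comment> \<open>The threshold \<open>\<epsilon> / 2\<close> is positive, as density requires,
    and smaller than the length \<open>\<epsilon>\<close> of the arc, as this inclusion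
    requires.\<close>
  have "rarely_visiting \<alpha> \<beta> {0..<\<epsilon>} (\<epsilon> / 2) \<subseteq> exceptional_set \<alpha> \<beta>"
    using eps by (intro rarely_visiting_subset_exceptional_set) (auto simp: is_interval_1)
  then show ?thesis
    using gdelta_in_rarely_visiting dense_rarely_visiting[OF _ avoid, of "\<epsilon> / 2"] eps
    by (intro exI[of _ "rarely_visiting \<alpha> \<beta> {0..<\<epsilon>} (\<epsilon> / 2)"]) simp
qed

end
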